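(* The operator $c$ is normal if and only if $W_k(c)$ is a polygon for every integer $k$ with $0<k<n$.
   Context: $c$ is a linear operator on an $n$-dimensional complex Hilbert space $H$. The $k$-numerical range of $c$ is $W_k(c)=\left\{\frac1k\sum_{i=1}^k\langle c\mathbf{x}_i,\mathbf{x}_i\rangle:\ \mathbf{x}_1,\dots,\mathbf{x}_k\in H \text{ orthonormal}\right\}\subset\mathbb{C}$. "Polygon" means the convex hull of a finite set of points in $\mathbb{C}$ (degenerate cases, i.e. line segments and single points, are included). *)

theory Defs
  imports "HOL-Analysis.Analysis"
begin

text \<open>
  Inner products are linear in the first argument. Completeness is not listed among the
  axioms, since every finite-dimensional complex inner product space is complete.
\<close>

locale finite_dim_complex_hilbert = vector_space scale
  for scale :: "complex \<Rightarrow> 'a::ab_group_add \<Rightarrow> 'a" +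
  fixes ip :: "'a \<Rightarrow> 'a \<Rightarrow> complex"
  assumes ip_add_left: "ip (x + y) z = ip x z + ip y z"
    and ip_scale_left: "ip (scale a x) y = a * ip x y"
    and ip_commute: "ip y x = cnj (ip x y)"
    and ip_nonneg: "0 \<le> Re (ip x x)"
    and ip_definite: "ip x x = 0 \<Longrightarrow> x = 0"
    and finite_dim: "\<exists>B. finite B \<and> span B = UNIV"

text \<open>
  Such a map exists and is unique whenever \<open>c\<close> is linear on a finite-dimensional space.
\<close>

definition hilbert_adjoint :: "('a \<Rightarrow> 'a \<Rightarrow> complex) \<Rightarrow> ('a \<Rightarrow> 'a) \<Rightarrow> 'a \<Rightarrow> 'a" where
  "hilbert_adjoint ip c = (THE d. \<forall>x y. ip (c x) y = ip x (d y))"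

definition normal_operator :: "('a \<Rightarrow> 'a \<Rightarrow> complex) \<Rightarrow> ('a \<Rightarrow> 'a) \<Rightarrow> bool" where
  "normal_operator ip c \<longleftrightarrow> c \<circ> hilbert_adjoint ip c = hilbert_adjoint ip c \<circ> c"

definition orthonormal_tuple :: "('a \<Rightarrow> 'a \<Rightarrow> complex) \<Rightarrow> nat \<Rightarrow> (nat \<Rightarrow> 'a) \<Rightarrow> bool" where
  "orthonormal_tuple ip k x \<longleftrightarrow>
     (\<forall>i\<in>{1..k}. \<forall>j\<in>{1..k}. ip (x i) (x j) = (if i = j then 1 else 0))"

definition k_numerical_range ::
    "('a \<Rightarrow> 'a \<Rightarrow> complex) \<Rightarrow> nat \<Rightarrow> ('a \<Rightarrow> 'a) \<Rightarrow> complex set" where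
  "k_numerical_range ip k c =
     {1 / of_nat k * (\<Sum>i=1..k. ip (c (x i)) (x i)) | x. orthonormal_tuple ip k x}"

end

theory Submission
  imports Defs "HOL-Computational_Algebra.Fundamental_Theorem_Algebra"
begin

text \<open>
  If \<open>x\<^sub>1, \<dots>, x\<^sub>k\<close> is orthonormal and \<open>P\<close> is the projection onto its span, the corresponding
  point of the range is \<open>tr (P c) / k\<close>.  In an orthonormal basis \<open>e\<close> in which \<open>c\<close> is diagonal
  with eigenvalues \<open>\<kappa>\<close>, this point depends only on the diagonal
  \<open>p\<^sub>j = \<Sum>\<^sub>i \<bar>\<langle>x\<^sub>i, e\<^sub>j\<rangle>\<bar>\<^sup>2\<close> of \<open>P\<close>, and equals \<open>(\<Sum>\<^sub>j p\<^sub>j \<kappa>\<^sub>j) / k\<close>.  By Bessel and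
  Parseval, \<open>p\<close> lies in the hypersimplex, the set of vectors with entries in \<open>[0, 1]\<close> and sum \<open>k\<close>.

  A normal operator is diagonal in some orthonormal basis (\<open>normal_eigenbasis\<close>).  Conversely to
  Bessel, every point of the hypersimplex is the diagonal of a rank \<open>k\<close> projection
  (\<open>carpenter\<close>), so the range is a linear image of the hypersimplex.  The hypersimplex has the
  \<open>0\<close>-\<open>1\<close> vectors as its vertices, and hence the range is the convex hull of the averages of \<open>k\<close>
  eigenvalues (\<open>polytope_hypersimplex_image\<close>).

  Now let the ranges for \<open>0 < k < n\<close> be polygons.  Only finitely many directions \<open>w\<close> are
  orthogonal to a difference of two vertices of one of these polygons; fix any other \<open>w\<close>.
  The quadratic form of the self-adjoint operator \<open>(w\<^sup>* c + w c\<^sup>*) / 2\<close>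
  is \<open>x \<mapsto> w \<bullet> \<langle>c x, x\<rangle>\<close>.  Let \<open>e\<close> be an orthonormal basis of its eigenvectors, with decreasing
  eigenvalues.  By Ky Fan's maximum principle (\<open>hypersimplex_sum_le_top\<close>), the first \<open>k\<close>
  basis vectors give a point of the \<open>k\<close>-th range that maximises \<open>w \<bullet> z\<close>.  By the choice of \<open>w\<close>
  this point is a vertex and the range is contained in a cone at it with an angle
  less than \<open>\<pi>\<close> (\<open>unique_maximum_is_corner\<close>).
  A differentiable curve in the range must pass through such a vertex with velocity zero.  Rotating
  \<open>e\<^sub>j\<close>, for \<open>j \<le> k\<close>, towards \<open>u e\<^sub>l\<close>, for \<open>l > k\<close> and \<open>\<bar>u\<bar> = 1\<close>, yields such a curve.
  Its velocity is \<open>(u \<langle>c e\<^sub>l, e\<^sub>j\<rangle> + u\<^sup>* \<langle>c e\<^sub>j, e\<^sub>l\<rangle>) / k\<close>, which vanishes for all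
  \<open>u\<close> only if both inner products are zero (\<open>corner_tuple_decouples\<close>).  Taking all \<open>k\<close>, the
  operator \<open>c\<close> is diagonal in the basis \<open>e\<close> and therefore normal.
\<close>

section \<open>Weights in the hypersimplex\<close>

definition hypersimplex :: "nat \<Rightarrow> nat \<Rightarrow> (nat \<Rightarrow> real) set" where
  "hypersimplex n k =
     {p. (\<forall>j\<in>{1..n}. 0 \<le> p j \<and> p j \<le> 1) \<and> (\<Sum>j=1..n. p j) = real k}"

definition fractional :: "nat \<Rightarrow> (nat \<Rightarrow> real) \<Rightarrow> nat set" where
  "fractional n p = {j\<in>{1..n}. p j \<noteq> 0 \<and> p j \<noteq> 1}"

lemma finite_fractional [simp]: "finite (fractional n p)"
  by (simp add: fractional_def)

lemma fractional_bounds: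
  assumes "p \<in> hypersimplex n k" "j \<in> fractional n p"
  shows "j \<in> {1..n}" "0 < p j" "p j < 1"
  using assms by (auto simp: hypersimplex_def fractional_def less_le)

lemma sum_zero_one:
  fixes f :: "nat \<Rightarrow> 'b::real_vector"
  assumes "finite A" "\<And>j. j \<in> A \<Longrightarrow> p j = 0 \<or> p j = (1::real)"
  shows "(\<Sum>j\<in>A. p j *\<^sub>R f j) = (\<Sum>j\<in>{j\<in>A. p j = 1}. f j)"
proof -
  have "(\<Sum>j\<in>A. p j *\<^sub>R f j) = (\<Sum>j\<in>A. if p j = 1 then f j else 0)"
    using assms(2) by (intro sum.cong) auto
  also have "\<dots> = (\<Sum>j\<in>{j\<in>A. p j = 1}. f j)"
    using assms(1) by (simp add: sum.inter_filter)
  finally show ?thesis .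
qed

text \<open>
  The sum of the entries is an integer, so it is impossible that just one entry is fractional.
\<close>

lemma fractional_partner:
  assumes p: "p \<in> hypersimplex n k" and a: "a \<in> fractional n p"
  obtains b where "b \<in> fractional n p" "b \<noteq> a"
proof -
  have "\<exists>b\<in>fractional n p. b \<noteq> a"
  proof (rule ccontr)
    assume "\<not> ?thesis"
    hence *: "p j = 0 \<or> p j = 1" if "j \<in> {1..n} - {a}" for j
      using that by (auto simp: fractional_def)
    let ?m = "card {j \<in> {1..n} - {a}. p j = 1}"
    note ab = fractional_bounds[OF p a]
    have "real k = (\<Sum>j=1..n. p j)"
      using p by (simp add: hypersimplex_def)
    also have "\<dots> = p a + (\<Sum>j\<in>{1..n} - {a}. p j)"
      using ab by (simp add: sum.remove)
    also have "(\<Sum>j\<in>{1..n} - {a}. p j) = real ?m"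
      using sum_zero_one[of "{1..n} - {a}" p "\<lambda>_. 1::real"] * by simp
    finally have "p a = of_int (int k - int ?m)" by simp
    hence "0 < int k - int ?m" "int k - int ?m < 1"
      using ab by (simp_all only: of_int_0_less_iff of_int_less_1_iff)
    thus False by simp
  qed
  thus ?thesis using that by blast
qed

text \<open>
  The largest mass that can be moved from entry \<open>b\<close> to entry \<open>a\<close> without leaving \<open>[0, 1]\<close>.
\<close>

definition shift_amount :: "(nat \<Rightarrow> real) \<Rightarrow> nat \<Rightarrow> nat \<Rightarrow> real" where
  "shift_amount p a b = min (1 - p a) (p b)"

definition shift_weight :: "(nat \<Rightarrow> real) \<Rightarrow> nat \<Rightarrow> nat \<Rightarrow> nat \<Rightarrow> real" where
  "shift_weight p a b = p(a := p a + shift_amount p a b, b := p b - shift_amount p a b)"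

lemma sum_shift_weight:
  fixes f :: "nat \<Rightarrow> 'b::real_vector"
  assumes "a \<in> {1..n}" "b \<in> {1..n}" "a \<noteq> b"
  shows "(\<Sum>j=1..n. shift_weight p a b j *\<^sub>R f j) =
           (\<Sum>j=1..n. p j *\<^sub>R f j) + shift_amount p a b *\<^sub>R (f a - f b)"
proof -
  have split: "(\<Sum>j=1..n. g j *\<^sub>R f j) =
      g a *\<^sub>R f a + (g b *\<^sub>R f b + (\<Sum>j\<in>{1..n}-{a}-{b}. g j *\<^sub>R f j))" for g
    using assms sum.remove[of "{1..n}" a "\<lambda>j. g j *\<^sub>R f j"]
      sum.remove[of "{1..n}-{a}" b "\<lambda>j. g j *\<^sub>R f j"] by simp
  have "(\<Sum>j\<in>{1..n}-{a}-{b}. shift_weight p a b j *\<^sub>R f j) =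
      (\<Sum>j\<in>{1..n}-{a}-{b}. p j *\<^sub>R f j)"
    by (intro sum.cong) (auto simp: shift_weight_def)
  thus ?thesis
    unfolding split using assms(3) by (simp add: shift_weight_def algebra_simps)
qed

text \<open>
  Moving as much mass as possible fills entry \<open>a\<close> or empties entry \<open>b\<close>.  This decreases the number
  of fractional entries, on which the inductions below run.
\<close>

lemma shift_weight:
  assumes p: "p \<in> hypersimplex n k" and a: "a \<in> fractional n p" and b: "b \<in> fractional n p"
    and ne: "a \<noteq> b"
  shows "0 < shift_amount p a b"
    and "shift_weight p a b \<in> hypersimplex n k"
    and "card (fractional n (shift_weight p a b)) < card (fractional n p)"
    and "shift_weight p a b a = 1 \<or> shift_weight p a b b = 0"
proof -
  let ?q = "shift_weight p a b"
  note A = fractional_bounds[OF p a] and B = fractional_bounds[OF p b]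
  show "0 < shift_amount p a b" using A B by (auto simp: shift_amount_def)
  show ends: "?q a = 1 \<or> ?q b = 0"
    using ne by (auto simp: shift_weight_def shift_amount_def min_def)
  have "(\<Sum>j=1..n. ?q j) = real k"
    using sum_shift_weight[OF A(1) B(1) ne, of p "\<lambda>_. 1::real"] p by (simp add: hypersimplex_def)
  moreover have "0 \<le> ?q j \<and> ?q j \<le> 1" if "j \<in> {1..n}" for j
    using that p A B by (auto simp: hypersimplex_def shift_weight_def shift_amount_def min_def)
  ultimately show "?q \<in> hypersimplex n k" by (simp add: hypersimplex_def)
  have "fractional n ?q \<subseteq> fractional n p"
    using a b by (auto simp: fractional_def shift_weight_def split: if_splits)
  moreover have "a \<notin> fractional n ?q \<or> b \<notin> fractional n ?q"
    using ends by (auto simp: fractional_def)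
  ultimately have "fractional n ?q \<subset> fractional n p" using a b by blast
  thus "card (fractional n ?q) < card (fractional n p)" by (simp add: psubset_card_mono)
qed

lemma card_ones:
  assumes p: "p \<in> hypersimplex n k" and "fractional n p = {}"
  shows "card {j\<in>{1..n}. p j = 1} = k"
proof -
  have "real k = (\<Sum>j=1..n. p j)" using p by (simp add: hypersimplex_def)
  also have "\<dots> = real (card {j\<in>{1..n}. p j = 1})"
    using sum_zero_one[of "{1..n}" p "\<lambda>_. 1::real"] assms(2) by (auto simp: fractional_def)
  finally show ?thesis by simp
qed

text \<open>
  The vertices of the hypersimplex are its \<open>0\<close>-\<open>1\<close> vectors: any other point has two fractional
  entries and is an interior point of the segment along which mass moves between them.
\<close>

lemma hypersimplex_sum_in_hull:
  fixes f :: "nat \<Rightarrow> 'b::real_vector"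
  assumes "p \<in> hypersimplex n k"
  shows "(\<Sum>j=1..n. p j *\<^sub>R f j) \<in> convex hull {(\<Sum>j\<in>S. f j) | S. S \<subseteq> {1..n} \<and> card S = k}"
    (is "_ \<in> ?H")
  using assms
proof (induction "card (fractional n p)" arbitrary: p rule: less_induct)
  case less
  note p = less.prems
  let ?F = "\<lambda>p. \<Sum>j=1..n. p j *\<^sub>R f j"
  show ?case
  proof (cases "fractional n p = {}")
    case True
    hence "?F p = (\<Sum>j\<in>{j\<in>{1..n}. p j = 1}. f j)"
      by (intro sum_zero_one) (auto simp: fractional_def)
    moreover have "card {j\<in>{1..n}. p j = 1} = k" using card_ones[OF p True] .
    ultimately show ?thesis by (intro hull_inc CollectI exI[of _ "{j\<in>{1..n}. p j = 1}"]) auto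
  next
    case False
    then obtain a where a: "a \<in> fractional n p" by blast
    obtain b where b: "b \<in> fractional n p" "b \<noteq> a" using fractional_partner[OF p a] .
    note A = fractional_bounds[OF p a] and B = fractional_bounds[OF p b(1)]
    note ab = shift_weight[OF p a b(1) b(2)[symmetric]] and ba = shift_weight[OF p b(1) a b(2)]
    let ?t = "shift_amount p a b" and ?s = "shift_amount p b a"
    \<comment> \<open>The point lies on the segment between the two extreme shifts of mass between \<open>a\<close> and \<open>b\<close>.\<close>
    have Fab: "?F (shift_weight p a b) = ?F p + ?t *\<^sub>R (f a - f b)"
      using A(1) B(1) b(2) by (intro sum_shift_weight) auto
    have Fba: "?F (shift_weight p b a) = ?F p + ?s *\<^sub>R (f b - f a)"
      using A(1) B(1) b(2) by (intro sum_shift_weight) auto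
    have "(?s / (?s + ?t)) *\<^sub>R ?F (shift_weight p a b)
        + (?t / (?s + ?t)) *\<^sub>R ?F (shift_weight p b a)
        = (?s / (?s + ?t) + ?t / (?s + ?t)) *\<^sub>R ?F p"
      unfolding Fab Fba by (simp add: algebra_simps)
    also have "?s / (?s + ?t) + ?t / (?s + ?t) = 1"
      using ab(1) ba(1) by (simp add: add_divide_distrib[symmetric])
    finally have eq: "?F p = (?s / (?s + ?t)) *\<^sub>R ?F (shift_weight p a b)
        + (?t / (?s + ?t)) *\<^sub>R ?F (shift_weight p b a)" by simp
    have "?F (shift_weight p a b) \<in> ?H" "?F (shift_weight p b a) \<in> ?H"
      using less.hyps ab ba by blast+
    thus ?thesis unfolding eq
      using ab(1) ba(1) by (intro convexD[OF convex_convex_hull])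
        (auto simp: add_divide_distrib[symmetric])
  qed
qed

lemma convex_hypersimplex_image:
  fixes f :: "nat \<Rightarrow> 'b::real_vector"
  shows "convex ((\<lambda>p. \<Sum>j=1..n. p j *\<^sub>R f j) ` hypersimplex n k)"
proof (rule convexI)
  fix x y :: 'b and u v :: real
  assume xy: "x \<in> (\<lambda>p. \<Sum>j=1..n. p j *\<^sub>R f j) ` hypersimplex n k"
    "y \<in> (\<lambda>p. \<Sum>j=1..n. p j *\<^sub>R f j) ` hypersimplex n k" and uv: "0 \<le> u" "0 \<le> v" "u + v = 1"
  then obtain p q where p: "p \<in> hypersimplex n k" "x = (\<Sum>j=1..n. p j *\<^sub>R f j)"
    and q: "q \<in> hypersimplex n k" "y = (\<Sum>j=1..n. q j *\<^sub>R f j)" by blast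
  let ?r = "\<lambda>j. u * p j + v * q j"
  have "u *\<^sub>R x + v *\<^sub>R y = (\<Sum>j=1..n. ?r j *\<^sub>R f j)"
    by (simp add: p q scaleR_sum_right sum.distrib algebra_simps)
  moreover have "?r \<in> hypersimplex n k"
  proof -
    have "(\<Sum>j=1..n. ?r j) = (u + v) * real k"
      using p q by (simp add: hypersimplex_def sum.distrib sum_distrib_left[symmetric] algebra_simps)
    moreover have "0 \<le> ?r j \<and> ?r j \<le> 1" if "j \<in> {1..n}" for j
    proof -
      have "0 \<le> p j" "p j \<le> 1" "0 \<le> q j" "q j \<le> 1"
        using that p q by (auto simp: hypersimplex_def)
      thus ?thesis using uv convex_bound_le[of "p j" 1 "q j" u v] by simp
    qed
    ultimately show ?thesis using uv by (simp add: hypersimplex_def)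
  qed
  ultimately show "u *\<^sub>R x + v *\<^sub>R y \<in> (\<lambda>p. \<Sum>j=1..n. p j *\<^sub>R f j) ` hypersimplex n k" by (rule image_eqI)
qed

lemma polytope_hypersimplex_image:
  fixes f :: "nat \<Rightarrow> 'b::real_vector"
  shows "polytope ((\<lambda>p. \<Sum>j=1..n. p j *\<^sub>R f j) ` hypersimplex n k)"
proof -
  let ?V = "{(\<Sum>j\<in>S. f j) | S. S \<subseteq> {1..n} \<and> card S = k}"
  let ?I = "(\<lambda>p. \<Sum>j=1..n. p j *\<^sub>R f j) ` hypersimplex n k"
  have "?I = convex hull ?V"
  proof
    show "?I \<subseteq> convex hull ?V" using hypersimplex_sum_in_hull by blast
    have "?V \<subseteq> ?I"
    proof
      fix v assume "v \<in> ?V"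
      then obtain S where S: "S \<subseteq> {1..n}" "card S = k" "v = (\<Sum>j\<in>S. f j)" by blast
      let ?p = "\<lambda>j. if j \<in> S then 1 else 0 :: real"
      have ones: "{j \<in> {1..n}. ?p j = 1} = S" using S(1) by auto
      have "(\<Sum>j=1..n. ?p j *\<^sub>R g j) = sum g S" for g :: "nat \<Rightarrow> 'c::real_vector"
        using sum_zero_one[of "{1..n}" ?p g] unfolding ones by simp
      from this[of f] this[of "\<lambda>_. 1::real"]
      have "v = (\<Sum>j=1..n. ?p j *\<^sub>R f j)" "?p \<in> hypersimplex n k"
        using S by (auto simp: hypersimplex_def)
      thus "v \<in> ?I" by (rule image_eqI)
    qed
    thus "convex hull ?V \<subseteq> ?I" by (rule hull_minimal) (rule convex_hypersimplex_image)
  qed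
  moreover have "finite ?V"
    by (rule finite_subset[of _ "(\<lambda>S. \<Sum>j\<in>S. f j) ` Pow {1..n}"]) auto
  ultimately show ?thesis unfolding polytope_def by blast
qed

text \<open>
  This is the combinatorial half of Ky Fan's maximum principle; the other half is that the diagonal
  of a projection lies in the hypersimplex.
\<close>

lemma hypersimplex_sum_le_top:
  fixes \<mu> :: "nat \<Rightarrow> real"
  assumes p: "p \<in> hypersimplex n k" and k: "0 < k" "k \<le> n"
    and mono: "\<And>i j. \<lbrakk>i \<in> {1..n}; j \<in> {1..n}; i \<le> j\<rbrakk> \<Longrightarrow> \<mu> j \<le> \<mu> i"
  shows "(\<Sum>j=1..n. p j * \<mu> j) \<le> (\<Sum>j=1..k. \<mu> j)"
proof -
  let ?\<chi> = "\<lambda>j. if j \<le> k then 1 else 0 :: real"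
  have top: "(\<Sum>j=1..n. ?\<chi> j * g j) = (\<Sum>j=1..k. g j)" for g :: "nat \<Rightarrow> real"
  proof -
    have "(\<Sum>j=1..n. ?\<chi> j * g j) = (\<Sum>j\<in>{j\<in>{1..n}. j \<le> k}. g j)"
      by (subst sum.inter_filter) (auto intro: sum.cong)
    also have "{j\<in>{1..n}. j \<le> k} = {1..k}" using k by auto
    finally show ?thesis .
  qed
  \<comment> \<open>Subtracting the constant \<open>\<mu> k\<close> changes nothing, as \<open>p\<close> and \<open>?\<chi>\<close> have the same sum, but
    makes each summand nonpositive.\<close>
  have "(\<Sum>j=1..n. (p j - ?\<chi> j) * (\<mu> j - \<mu> k)) \<le> 0"
  proof (rule sum_nonpos)
    fix j assume j: "j \<in> {1..n}"
    hence "0 \<le> p j" "p j \<le> 1" using p by (auto simp: hypersimplex_def)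
    moreover have "j \<le> k \<Longrightarrow> \<mu> k \<le> \<mu> j" "\<not> j \<le> k \<Longrightarrow> \<mu> j \<le> \<mu> k"
      using mono j k by auto
    ultimately show "(p j - ?\<chi> j) * (\<mu> j - \<mu> k) \<le> 0" by (auto simp: mult_le_0_iff)
  qed
  also have "(\<Sum>j=1..n. (p j - ?\<chi> j) * (\<mu> j - \<mu> k)) =
      (\<Sum>j=1..n. p j * \<mu> j) - (\<Sum>j=1..n. ?\<chi> j * \<mu> j)
        - \<mu> k * ((\<Sum>j=1..n. p j) - (\<Sum>j=1..n. ?\<chi> j * 1))"
    by (simp only: sum_subtractf[symmetric] sum_distrib_left)
       (intro sum.cong, auto simp: algebra_simps)
  also have "(\<Sum>j=1..n. p j) - (\<Sum>j=1..n. ?\<chi> j * 1) = 0"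
    using p by (simp only: top) (simp add: hypersimplex_def)
  finally show ?thesis by (simp only: top)
qed

section \<open>Corners of a polygon\<close>

text \<open>
  Each nonzero \<open>d\<close> is orthogonal to \<open>1 + \<i> t\<close> for at most one real \<open>t\<close>, so that some \<open>t\<close>
  avoids all members of a finite set.
\<close>

lemma ex_direction_nonorthogonal:
  fixes D :: "complex set"
  assumes "finite D" "0 \<notin> D"
  obtains w :: complex where "\<And>d. d \<in> D \<Longrightarrow> w \<bullet> d \<noteq> 0"
proof -
  have "finite ((\<lambda>d. - Re d / Im d) ` D)" using assms by simp
  then obtain t :: real where t: "t \<notin> (\<lambda>d. - Re d / Im d) ` D"
    using ex_new_if_finite[OF infinite_UNIV_char_0] by blast
  have "Complex 1 t \<bullet> d \<noteq> 0" if d: "d \<in> D" for d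
  proof (cases "Im d = 0")
    case True
    hence "Re d \<noteq> 0" using d assms(2) by (metis complex_eq_iff zero_complex.simps)
    thus ?thesis using True by (simp add: inner_complex_def)
  next
    case False
    have "t \<noteq> - Re d / Im d" using t d by blast
    hence "t * Im d \<noteq> - Re d" using False by (simp add: field_simps)
    thus ?thesis by (simp add: inner_complex_def)
  qed
  thus ?thesis using that by blast
qed

text \<open>
  A linear functional that separates the vertices is maximal at only one of them.  Finiteness of \<open>V\<close>
  gives a uniform slope \<open>\<epsilon>\<close> at which it decreases from there, which is what makes
  the maximiser a corner and not merely an extreme point.
\<close>

lemma unique_maximum_is_corner:
  fixes V :: "'b::real_inner set"
  assumes fin: "finite V" and inj: "\<And>u v. \<lbrakk>u \<in> V; v \<in> V; u \<noteq> v\<rbrakk> \<Longrightarrow> w \<bullet> (u - v) \<noteq> 0"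
    and m: "m \<in> convex hull V" and max: "\<And>z. z \<in> convex hull V \<Longrightarrow> w \<bullet> z \<le> w \<bullet> m"
  obtains \<epsilon> where "\<epsilon> > 0" "\<And>z. z \<in> convex hull V \<Longrightarrow> w \<bullet> (z - m) + \<epsilon> * norm (z - m) \<le> 0"
proof -
  have "V \<noteq> {}" using m by auto
  hence "Max ((\<bullet>) w ` V) \<in> (\<bullet>) w ` V" using fin by simp
  then obtain v where v: "v \<in> V" "Max ((\<bullet>) w ` V) = w \<bullet> v" by blast
  have v_max: "w \<bullet> u \<le> w \<bullet> v" if "u \<in> V" for u
    using Max_ge[of "(\<bullet>) w ` V" "w \<bullet> u"] fin that v(2) by simp
  have strict: "w \<bullet> u < w \<bullet> v" if "u \<in> V" "u \<noteq> v" for u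
    using v_max[OF that(1)] inj[OF that(1) v(1) that(2)] by (simp add: inner_diff_right)
  obtain \<epsilon> where \<epsilon>: "\<epsilon> > 0" "\<And>u. u \<in> V - {v} \<Longrightarrow> \<epsilon> \<le> w \<bullet> (v - u) / norm (u - v)"
  proof (cases "V - {v} = {}")
    case True
    thus ?thesis using that[OF zero_less_one] by blast
  next
    case False
    let ?R = "(\<lambda>u. w \<bullet> (v - u) / norm (u - v)) ` (V - {v})"
    have "Min ?R \<in> ?R" using False fin by (intro Min_in) auto
    moreover have "0 < w \<bullet> (v - u) / norm (u - v)" if "u \<in> V - {v}" for u
      using strict[of u] that by (intro divide_pos_pos) (auto simp: inner_diff_right)
    ultimately have "Min ?R > 0" by (metis (no_types, lifting) imageE)
    thus ?thesis using that[of "Min ?R"] fin by auto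
  qed
  \<comment> \<open>The inequality describes a convex set, so it passes from the vertices to the hull.\<close>
  let ?C = "{z. w \<bullet> (z - v) + \<epsilon> * norm (z - v) \<le> 0}"
  have "convex ?C"
  proof (rule convexI)
    fix x y and s t :: real
    assume xy: "x \<in> ?C" "y \<in> ?C" and st: "0 \<le> s" "0 \<le> t" "s + t = 1"
    have "v = s *\<^sub>R v + t *\<^sub>R v" using st(3) by (metis scaleR_add_left scaleR_one)
    hence eq: "s *\<^sub>R x + t *\<^sub>R y - v = s *\<^sub>R (x - v) + t *\<^sub>R (y - v)"
      by (simp add: algebra_simps)
    have "\<epsilon> * norm (s *\<^sub>R x + t *\<^sub>R y - v) \<le> \<epsilon> * (s * norm (x - v) + t * norm (y - v))"
      unfolding eq using norm_triangle_ineq[of "s *\<^sub>R (x - v)" "t *\<^sub>R (y - v)"] st \<epsilon>(1)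
      by (intro mult_left_mono) auto
    hence "w \<bullet> (s *\<^sub>R x + t *\<^sub>R y - v) + \<epsilon> * norm (s *\<^sub>R x + t *\<^sub>R y - v)
        \<le> s * (w \<bullet> (x - v) + \<epsilon> * norm (x - v)) + t * (w \<bullet> (y - v) + \<epsilon> * norm (y - v))"
      unfolding eq inner_add_right inner_scaleR_right by (simp add: algebra_simps)
    also have "\<dots> \<le> 0" using xy st by (auto intro: add_nonpos_nonpos mult_nonneg_nonpos)
    finally show "s *\<^sub>R x + t *\<^sub>R y \<in> ?C" by simp
  qed
  moreover have "V \<subseteq> ?C"
  proof
    fix u assume u: "u \<in> V"
    show "u \<in> ?C"
    proof (cases "u = v")
      case False
      hence "\<epsilon> * norm (u - v) \<le> w \<bullet> (v - u)"
        using \<epsilon>(2)[of u] u by (simp add: pos_le_divide_eq)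
      thus ?thesis by (simp add: inner_diff_right)
    qed simp
  qed
  ultimately have C: "convex hull V \<subseteq> ?C" by (rule hull_minimal[rotated])
  have "m = v"
  proof -
    have "w \<bullet> v \<le> w \<bullet> m" using max hull_inc[of v V] v(1) by blast
    moreover have "w \<bullet> (m - v) + \<epsilon> * norm (m - v) \<le> 0" using C m by blast
    ultimately have "\<epsilon> * norm (m - v) \<le> 0" by (simp add: inner_diff_right)
    thus ?thesis using \<epsilon>(1) by (simp add: mult_le_0_iff)
  qed
  thus ?thesis using that[of \<epsilon>] \<epsilon>(1) C by blast
qed

text \<open>
  The curves \<open>s\<^sup>2 A \<plusminus> s \<surd>(1 - s\<^sup>2) D\<close> leave the apex with velocities \<open>D\<close> and \<open>- D\<close>.  If both stay
  in the pointed cone, so do \<open>D\<close> and \<open>- D\<close>, and a pointed cone contains no line.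
\<close>

lemma corner_tangent_zero:
  fixes A D w :: "'b::real_inner"
  assumes "\<epsilon> > 0"
    and cone: "\<And>s \<sigma>. \<lbrakk>0 < s; s < 1; \<sigma> = 1 \<or> \<sigma> = -1\<rbrakk> \<Longrightarrow>
      w \<bullet> (s\<^sup>2 *\<^sub>R A + (\<sigma> * s * sqrt (1 - s\<^sup>2)) *\<^sub>R D)
        + \<epsilon> * norm (s\<^sup>2 *\<^sub>R A + (\<sigma> * s * sqrt (1 - s\<^sup>2)) *\<^sub>R D) \<le> 0"
  shows "D = 0"
proof -
  have lim: "w \<bullet> (\<sigma> *\<^sub>R D) + \<epsilon> * norm (\<sigma> *\<^sub>R D) \<le> 0" if \<sigma>: "\<sigma> = 1 \<or> \<sigma> = -1" for \<sigma> :: real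
  proof -
    let ?g = "\<lambda>s. s *\<^sub>R A + (\<sigma> * sqrt (1 - s\<^sup>2)) *\<^sub>R D"
    have "((\<lambda>s. w \<bullet> ?g s + \<epsilon> * norm (?g s)) \<longlongrightarrow>
        w \<bullet> ?g 0 + \<epsilon> * norm (?g 0)) (at_right 0)"
      by (intro tendsto_intros)
    moreover have "w \<bullet> ?g s + \<epsilon> * norm (?g s) \<le> 0" if s: "0 < s" "s < 1" for s
    proof -
      have eq: "s\<^sup>2 *\<^sub>R A + (\<sigma> * s * sqrt (1 - s\<^sup>2)) *\<^sub>R D = s *\<^sub>R ?g s"
        by (simp add: algebra_simps power2_eq_square)
      have "s * (w \<bullet> ?g s + \<epsilon> * norm (?g s)) \<le> 0"
        using cone[OF s \<sigma>] s unfolding eq inner_scaleR_right norm_scaleR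
        by (simp add: distrib_left mult.left_commute)
      thus ?thesis using s by (simp add: mult_le_0_iff)
    qed
    hence "eventually (\<lambda>s. w \<bullet> ?g s + \<epsilon> * norm (?g s) \<le> 0) (at_right 0)"
      unfolding eventually_at_right_field using zero_less_one by blast
    ultimately have "w \<bullet> ?g 0 + \<epsilon> * norm (?g 0) \<le> 0"
      by (intro tendsto_upperbound) auto
    thus ?thesis by simp
  qed
  have "\<epsilon> * norm D \<le> 0" using lim[of 1] lim[of "-1"] by simp
  thus ?thesis using assms(1) by (simp add: mult_le_0_iff)
qed

section \<open>Orthonormal tuples\<close>

context finite_dim_complex_hilbert
begin

lemma ip_add_right: "ip x (y + z) = ip x y + ip x z"
  by (metis ip_add_left ip_commute complex_cnj_add)

lemma ip_scale_right: "ip x (scale a y) = cnj a * ip x y"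
  by (metis ip_scale_left ip_commute complex_cnj_mult)

lemma ip_zero_left [simp]: "ip 0 y = 0"
  using ip_add_left[of 0 0 y] by simp

lemma ip_zero_right [simp]: "ip x 0 = 0"
  using ip_add_right[of x 0 0] by simp

lemma ip_minus_left: "ip (- x) y = - ip x y"
  using ip_add_left[of x "- x" y] by (simp add: add_eq_0_iff)

lemma ip_diff_left: "ip (x - y) z = ip x z - ip y z"
  using ip_add_left[of x "- y" z] by (simp add: ip_minus_left)

lemma ip_diff_right: "ip x (y - z) = ip x y - ip x z"
  by (metis ip_diff_left ip_commute complex_cnj_diff)

lemma ip_sum_left: "ip (\<Sum>i\<in>A. f i) y = (\<Sum>i\<in>A. ip (f i) y)"
  by (induction A rule: infinite_finite_induct) (simp_all add: ip_add_left)

lemma ip_sum_right: "ip x (\<Sum>i\<in>A. f i) = (\<Sum>i\<in>A. ip x (f i))"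
  by (induction A rule: infinite_finite_induct) (simp_all add: ip_add_right)

lemmas ip_expand = ip_add_left ip_add_right ip_diff_left ip_diff_right
  ip_scale_left ip_scale_right ip_sum_left ip_sum_right

lemma ip_self: "ip x x = of_real (Re (ip x x))"
proof -
  have "Im (ip x x) = 0" using arg_cong[OF ip_commute[of x x], of Im] by simp
  thus ?thesis by (simp add: complex_eq_iff)
qed

lemma ip_self_eq_0_iff: "ip x x = 0 \<longleftrightarrow> x = 0"
  using ip_definite by auto

lemma ip_eq_0_commute: "ip x y = 0 \<longleftrightarrow> ip y x = 0"
  using ip_commute by (metis complex_cnj_zero)

lemma orthonormal_tupleD:
  assumes "orthonormal_tuple ip k x" "i \<in> {1..k}" "j \<in> {1..k}"
  shows "ip (x i) (x j) = (if i = j then 1 else 0)"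
  using assms by (auto simp: orthonormal_tuple_def)

lemma ip_residual:
  assumes x: "orthonormal_tuple ip k x" and j: "j \<in> {1..k}"
  shows "ip (y - (\<Sum>i=1..k. scale (ip y (x i)) (x i))) (x j) = 0"
proof -
  have "(\<Sum>i=1..k. ip y (x i) * ip (x i) (x j)) = (\<Sum>i=1..k. if i = j then ip y (x i) else 0)"
    using j by (intro sum.cong) (auto simp: orthonormal_tupleD[OF x])
  also have "\<dots> = ip y (x j)" using j by simp
  finally show ?thesis by (simp add: ip_expand)
qed

text \<open>
  This is \<open>\<langle>P y, y\<rangle>\<close> for the projection \<open>P\<close> onto the span of an orthonormal tuple \<open>x\<close>.  For \<open>y\<close>
  ranging over an orthonormal basis it gives the diagonal of \<open>P\<close>.
\<close>

definition weight :: "nat \<Rightarrow> (nat \<Rightarrow> 'a) \<Rightarrow> 'a \<Rightarrow> real" where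
  "weight k x y = (\<Sum>i=1..k. (cmod (ip (x i) y))\<^sup>2)"

lemma weight_nonneg: "0 \<le> weight k x y"
  by (simp add: weight_def sum_nonneg)

lemma ip_residual_self:
  assumes x: "orthonormal_tuple ip k x"
  defines "r \<equiv> \<lambda>y. y - (\<Sum>i=1..k. scale (ip y (x i)) (x i))"
  shows "ip (r y) (r y) = ip y y - of_real (weight k x y)"
proof -
  have "ip (r y) (\<Sum>i=1..k. scale (ip y (x i)) (x i)) = 0"
    unfolding ip_sum_right ip_scale_right r_def
    by (rule sum.neutral) (metis ip_residual[OF x] mult_zero_right)
  hence "ip (r y) (r y) = ip (r y) y"
    by (subst (2) r_def) (simp add: ip_diff_right)
  also have "\<dots> = ip y y - (\<Sum>i=1..k. ip y (x i) * ip (x i) y)"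
    by (simp add: r_def ip_expand)
  also have "(\<Sum>i=1..k. ip y (x i) * ip (x i) y) = of_real (weight k x y)"
    unfolding weight_def of_real_sum
    by (intro sum.cong refl) (metis ip_commute complex_norm_square mult.commute)
  finally show ?thesis .
qed

lemma weight_le_one:
  assumes "orthonormal_tuple ip k x" "ip y y = 1"
  shows "weight k x y \<le> 1"
  using ip_residual_self[OF assms(1), of y] assms(2)
    ip_nonneg[of "y - (\<Sum>i=1..k. scale (ip y (x i)) (x i))"] by simp

lemma weight_eq_one_expansion:
  assumes "orthonormal_tuple ip k x" "ip y y = 1" "weight k x y = 1"
  shows "y = (\<Sum>i=1..k. scale (ip y (x i)) (x i))"
  using ip_residual_self[OF assms(1), of y] assms(2,3) by (simp add: ip_self_eq_0_iff)

lemma orthonormal_tuple_update: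
  assumes "orthonormal_tuple ip k x" "ip y y = 1"
    and "\<And>i. \<lbrakk>i \<in> {1..k}; i \<noteq> a\<rbrakk> \<Longrightarrow> ip y (x i) = 0"
  shows "orthonormal_tuple ip k (x(a := y))"
proof -
  have "ip (x i) y = 0" if "i \<in> {1..k}" "i \<noteq> a" for i
    using assms(3)[OF that] ip_eq_0_commute by blast
  thus ?thesis using assms unfolding orthonormal_tuple_def by simp
qed

lemma orthonormal_tuple_reindex:
  assumes "orthonormal_tuple ip n e" "inj_on g {1..k}" "g ` {1..k} \<subseteq> {1..n}"
  shows "orthonormal_tuple ip k (\<lambda>i. e (g i))"
  using assms unfolding orthonormal_tuple_def
  by (auto simp: inj_on_eq_iff image_subset_iff)

lemma orthonormal_tuple_mono:
  "orthonormal_tuple ip n e \<Longrightarrow> k \<le> n \<Longrightarrow> orthonormal_tuple ip k e"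
  by (auto simp: orthonormal_tuple_def)

definition orthonormal_basis :: "nat \<Rightarrow> (nat \<Rightarrow> 'a) \<Rightarrow> bool" where
  "orthonormal_basis n e \<longleftrightarrow> orthonormal_tuple ip n e \<and>
     (\<forall>x. (\<forall>j\<in>{1..n}. ip x (e j) = 0) \<longrightarrow> x = 0)"

lemma orthonormal_basis_eqI:
  assumes "orthonormal_basis n e" "\<And>j. j \<in> {1..n} \<Longrightarrow> ip x (e j) = ip y (e j)"
  shows "x = y"
proof -
  have "\<forall>j\<in>{1..n}. ip (x - y) (e j) = 0" using assms(2) by (simp add: ip_diff_left)
  hence "x - y = 0" using assms(1) unfolding orthonormal_basis_def by blast
  thus ?thesis by simp
qed

lemma orthonormal_basis_expansion:
  assumes e: "orthonormal_basis n e"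
  shows "x = (\<Sum>j=1..n. scale (ip x (e j)) (e j))"
proof (rule eq_iff_diff_eq_0[THEN iffD2])
  have "\<forall>j\<in>{1..n}. ip (x - (\<Sum>j=1..n. scale (ip x (e j)) (e j))) (e j) = 0"
    using e ip_residual unfolding orthonormal_basis_def by blast
  thus "x - (\<Sum>j=1..n. scale (ip x (e j)) (e j)) = 0"
    using e unfolding orthonormal_basis_def by blast
qed

lemma parseval:
  assumes "orthonormal_basis n e"
  shows "ip x y = (\<Sum>j=1..n. ip x (e j) * cnj (ip y (e j)))"
proof -
  have "ip x y = ip (\<Sum>j=1..n. scale (ip x (e j)) (e j)) y"
    using orthonormal_basis_expansion[OF assms, of x] by simp
  also have "\<dots> = (\<Sum>j=1..n. ip x (e j) * cnj (ip y (e j)))"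
    by (simp add: ip_expand ip_commute[of _ y, symmetric])
  finally show ?thesis .
qed

lemma weight_in_hypersimplex:
  assumes e: "orthonormal_basis n e" and x: "orthonormal_tuple ip k x"
  shows "(\<lambda>j. weight k x (e j)) \<in> hypersimplex n k"
proof -
  have "of_real (\<Sum>j=1..n. weight k x (e j)) =
      (\<Sum>j=1..n. \<Sum>i=1..k. ip (x i) (e j) * cnj (ip (x i) (e j)))"
    by (simp add: weight_def complex_norm_square del: of_real_power)
  also have "\<dots> = (\<Sum>i=1..k. ip (x i) (x i))"
    by (subst sum.swap) (simp only: parseval[OF e, symmetric])
  also have "\<dots> = of_real (real k)" using orthonormal_tupleD[OF x] by simp
  finally have "(\<Sum>j=1..n. weight k x (e j)) = real k" by (simp only: of_real_eq_iff)
  moreover have "weight k x (e j) \<le> 1" if "j \<in> {1..n}" for j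
    using weight_le_one[OF x] orthonormal_tupleD[of n e j j] e that by (simp add: orthonormal_basis_def)
  ultimately show ?thesis by (simp add: hypersimplex_def weight_nonneg)
qed

text \<open>
  Let \<open>P\<close> be the projection onto the span of \<open>x\<close>.  The hypothesis on the weights says that \<open>P f = f\<close>
  or \<open>P g = 0\<close>.  In both cases \<open>\<langle>P f, g\<rangle> = 0\<close>, so the cross terms of the quadratic form vanish.
\<close>

lemma weight_rotation:
  fixes C S :: real
  assumes x: "orthonormal_tuple ip k x" and unit: "ip f f = 1" and orth: "ip f g = 0"
    and triv: "weight k x f = 1 \<or> weight k x g = 0"
  shows "weight k x (scale (of_real C) f + scale (of_real S) g) =
           C\<^sup>2 * weight k x f + S\<^sup>2 * weight k x g"
proof -
  have cross: "(\<Sum>i=1..k. ip (x i) f * cnj (ip (x i) g)) = 0"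
    using triv
  proof
    assume "weight k x g = 0"
    hence "ip (x i) g = 0" if "i \<in> {1..k}" for i
      using that by (auto simp: weight_def sum_nonneg_eq_0_iff)
    thus ?thesis by simp
  next
    assume "weight k x f = 1"
    hence f: "f = (\<Sum>i=1..k. scale (ip f (x i)) (x i))" by (rule weight_eq_one_expansion[OF x unit])
    have "0 = ip g (\<Sum>i=1..k. scale (ip f (x i)) (x i))"
      using orth f ip_eq_0_commute by metis
    also have "\<dots> = (\<Sum>i=1..k. ip (x i) f * cnj (ip (x i) g))"
      by (simp add: ip_expand ip_commute[of _ f, symmetric] ip_commute[of g, symmetric])
    finally show ?thesis by simp
  qed
  have expand: "(cmod (ip z (scale (of_real C) f + scale (of_real S) g)))\<^sup>2 =
      C\<^sup>2 * (cmod (ip z f))\<^sup>2 + S\<^sup>2 * (cmod (ip z g))\<^sup>2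
        + 2 * C * S * Re (ip z f * cnj (ip z g))" for z
    unfolding cmod_power2 by (simp add: ip_expand power2_eq_square algebra_simps)
  have "weight k x (scale (of_real C) f + scale (of_real S) g) =
      C\<^sup>2 * weight k x f + S\<^sup>2 * weight k x g
        + 2 * C * S * Re (\<Sum>i=1..k. ip (x i) f * cnj (ip (x i) g))"
    unfolding weight_def expand sum.distrib sum_distrib_left Re_sum by simp
  thus ?thesis unfolding cross by simp
qed

lemma orthonormal_tuple_rotate:
  fixes C S :: real
  assumes e: "orthonormal_tuple ip n e" and ab: "a \<in> {1..n}" "b \<in> {1..n}" "a \<noteq> b"
    and CS: "C\<^sup>2 + S\<^sup>2 = 1"
  shows "orthonormal_tuple ip n (e(a := scale (of_real C) (e a) - scale (of_real S) (e b),
                                   b := scale (of_real S) (e a) + scale (of_real C) (e b)))"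
proof -
  have CS': "complex_of_real C * of_real C + of_real S * of_real S = 1"
    using CS by (metis of_real_1 of_real_add of_real_mult power2_eq_square)
  define f g where "f = scale (of_real C) (e a) - scale (of_real S) (e b)"
    and "g = scale (of_real S) (e a) + scale (of_real C) (e b)"
  have ortho: "ip (e a) (e a) = 1" "ip (e b) (e b) = 1" "ip (e a) (e b) = 0" "ip (e b) (e a) = 0"
    using ab orthonormal_tupleD[OF e] by auto
  have pair: "ip f f = 1" "ip g g = 1" "ip f g = 0" "ip g f = 0"
    using CS' by (simp_all add: f_def g_def ip_expand ortho add.commute mult.commute)
  have other: "ip f (e i) = 0" "ip g (e i) = 0" "ip (e i) f = 0" "ip (e i) g = 0"
    if "i \<in> {1..n}" "i \<noteq> a" "i \<noteq> b" for i
    using that ab by (simp_all add: f_def g_def ip_expand orthonormal_tupleD[OF e])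
  have "ip ((e(a := f, b := g)) i) ((e(a := f, b := g)) j) = (if i = j then 1 else 0)"
    if "i \<in> {1..n}" "j \<in> {1..n}" for i j
    using that ab(3) by (simp add: pair other orthonormal_tupleD[OF e])
  thus ?thesis by (simp add: orthonormal_tuple_def f_def g_def)
qed

text \<open>
  Every point \<open>p\<close> of the hypersimplex is the diagonal of a projection of rank \<open>k\<close>.  If \<open>p\<close> is a
  \<open>0\<close>-\<open>1\<close> vector, the \<open>e\<^sub>j\<close> with \<open>p\<^sub>j = 1\<close> span its image.  Otherwise shift mass
  between two fractional entries \<open>a\<close> and \<open>b\<close>.  By induction, the shifted vector is the diagonal of a
  projection with respect to every orthonormal tuple, in particular one obtained from \<open>e\<close> by a rotation
  in the plane of \<open>e a\<close> and \<open>e b\<close>.  After the shift the projection has no off-diagonal entry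
  in this plane, so that rotating back only mixes the two diagonal entries.
\<close>

lemma carpenter:
  assumes "p \<in> hypersimplex n k" "orthonormal_tuple ip n e"
  shows "\<exists>x. orthonormal_tuple ip k x \<and> (\<forall>j\<in>{1..n}. weight k x (e j) = p j)"
  using assms
proof (induction "card (fractional n p)" arbitrary: p e rule: less_induct)
  case less
  note p = less.prems(1) and e = less.prems(2)
  show ?case
  proof (cases "fractional n p = {}")
    case True
    let ?A = "{j\<in>{1..n}. p j = 1}"
    have "card ?A = k" using card_ones[OF p True] .
    then obtain g where g: "bij_betw g {1..k} ?A"
      using finite_same_card_bij[of "{1..k}" ?A] by auto
    hence gA: "g ` {1..k} = ?A" and inj: "inj_on g {1..k}" by (auto simp: bij_betw_def)
    let ?x = "\<lambda>i. e (g i)"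
    have x: "orthonormal_tuple ip k ?x"
      using gA by (intro orthonormal_tuple_reindex[OF e inj]) auto
    moreover have "weight k ?x (e j) = p j" if j: "j \<in> {1..n}" for j
    proof -
      have "weight k ?x (e j) = (\<Sum>i\<in>g ` {1..k}. (cmod (ip (e i) (e j)))\<^sup>2)"
        unfolding weight_def sum.reindex[OF inj] o_def ..
      also have "\<dots> = (\<Sum>i\<in>?A. if i = j then 1 else 0)"
        unfolding gA using j by (intro sum.cong refl) (auto simp: orthonormal_tupleD[OF e])
      also have "\<dots> = p j" using j True by (auto simp: fractional_def)
      finally show ?thesis .
    qed
    ultimately show ?thesis by blast
  next
    case False
    then obtain a where a: "a \<in> fractional n p" by blast
    obtain b where b: "b \<in> fractional n p" "b \<noteq> a" using fractional_partner[OF p a] .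
    note A = fractional_bounds[OF p a] and B = fractional_bounds[OF p b(1)]
    let ?q = "shift_weight p a b"
    note q = shift_weight[OF p a b(1) b(2)[symmetric]]
    have qa: "?q a = p a + shift_amount p a b" and qb: "?q b = p b - shift_amount p a b"
      using b(2) by (simp_all add: shift_weight_def)
    have between: "?q b \<le> p a" "p a < ?q a"
      unfolding qa qb using q(1) A B by (auto simp: shift_amount_def min_def)
    \<comment> \<open>Since \<open>q b \<le> p a < q a\<close>, some rotation in the plane of \<open>e a\<close> and \<open>e b\<close> turns the
      diagonal entries \<open>q a, q b\<close> into \<open>p a, p b\<close>.\<close>
    define \<tau> where "\<tau> = (p a - ?q b) / (?q a - ?q b)"
    have \<tau>: "0 \<le> \<tau>" "\<tau> \<le> 1" using between by (auto simp: \<tau>_def field_simps)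
    have pa: "p a = \<tau> * ?q a + (1 - \<tau>) * ?q b"
    proof -
      have "\<tau> * (?q a - ?q b) = p a - ?q b" using between by (simp add: \<tau>_def)
      thus ?thesis by (simp add: algebra_simps)
    qed
    have pb: "p b = (1 - \<tau>) * ?q a + \<tau> * ?q b"
    proof -
      have "p b = ?q a + ?q b - p a" by (simp add: qa qb)
      thus ?thesis by (simp add: pa algebra_simps)
    qed
    define C S where "C = sqrt \<tau>" and "S = sqrt (1 - \<tau>)"
    have C2: "C\<^sup>2 = \<tau>" and S2: "S\<^sup>2 = 1 - \<tau>" using \<tau> by (simp_all add: C_def S_def)
    have CS: "C\<^sup>2 + S\<^sup>2 = 1" by (simp add: C2 S2)
    have CS': "complex_of_real C * of_real C + of_real S * of_real S = 1"
      using CS by (metis of_real_1 of_real_add of_real_mult power2_eq_square)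
    define f where "f = e(a := scale (of_real C) (e a) - scale (of_real S) (e b),
                          b := scale (of_real S) (e a) + scale (of_real C) (e b))"
    have fa: "f a = scale (of_real C) (e a) - scale (of_real S) (e b)"
      and fb: "f b = scale (of_real S) (e a) + scale (of_real C) (e b)"
      using b(2) by (simp_all add: f_def)
    have f: "orthonormal_tuple ip n f"
      unfolding f_def using A B b(2) CS by (intro orthonormal_tuple_rotate[OF e]) auto
    obtain x where x: "orthonormal_tuple ip k x" "\<And>j. j \<in> {1..n} \<Longrightarrow> weight k x (f j) = ?q j"
      using less.hyps[OF q(3) q(2) f] by blast
    have wa: "weight k x (f a) = ?q a" and wb: "weight k x (f b) = ?q b"
      using x(2) A B by blast+
    have unit: "ip (f a) (f a) = 1" and orth: "ip (f a) (f b) = 0"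
      using orthonormal_tupleD[OF f] A B b(2) by auto
    have triv: "weight k x (f a) = 1 \<or> weight k x (f b) = 0" using q(4) wa wb by simp
    have "scale (of_real C) (f a) + scale (of_real S) (f b)
        = scale (of_real C * of_real C + of_real S * of_real S) (e a)"
      unfolding fa fb by (simp add: scale_right_distrib scale_right_diff_distrib
          scale_left_distrib mult.commute)
    hence ea: "e a = scale (of_real C) (f a) + scale (of_real S) (f b)" by (simp add: CS')
    have "scale (of_real (- S)) (f a) + scale (of_real C) (f b)
        = scale (of_real C * of_real C + of_real S * of_real S) (e b)"
      unfolding fa fb by (simp add: scale_right_distrib scale_right_diff_distrib
          scale_left_distrib mult.commute)
    hence eb: "e b = scale (of_real (- S)) (f a) + scale (of_real C) (f b)" by (simp add: CS')
    have "weight k x (e j) = p j" if j: "j \<in> {1..n}" for j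
    proof -
      consider "j = a" | "j = b" | "j \<noteq> a" "j \<noteq> b" by blast
      thus ?thesis
      proof cases
        case 1
        thus ?thesis
          using weight_rotation[OF x(1) unit orth triv, of C S]
          by (simp add: ea[symmetric] wa wb C2 S2 pa[symmetric])
      next
        case 2
        thus ?thesis
          using weight_rotation[OF x(1) unit orth triv, of "- S" C]
          by (simp add: eb[symmetric] wa wb C2 S2 pb[symmetric] del: of_real_minus)
      next
        case 3
        thus ?thesis using x(2)[OF j] by (simp add: f_def shift_weight_def)
      qed
    qed
    thus ?thesis using x(1) by blast
  qed
qed

section \<open>Spectral theorem for normal operators\<close>

definition apply_poly :: "complex poly \<Rightarrow> ('a \<Rightarrow> 'a) \<Rightarrow> 'a \<Rightarrow> 'a" where
  "apply_poly p c x = (\<Sum>i\<le>degree p. scale (coeff p i) ((c ^^ i) x))"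

lemma apply_poly_altdef:
  assumes "degree p \<le> N"
  shows "apply_poly p c x = (\<Sum>i\<le>N. scale (coeff p i) ((c ^^ i) x))"
  unfolding apply_poly_def using assms
  by (intro sum.mono_neutral_left) (auto simp: coeff_eq_0)

lemma apply_poly_linear_factor:
  assumes c: "Vector_Spaces.linear scale scale c"
  shows "apply_poly ([:- a, 1:] * q) c x = c (apply_poly q c x) - scale a (apply_poly q c x)"
proof -
  interpret c: Vector_Spaces.linear scale scale c by (rule c)
  let ?N = "degree q"
  have coeff: "coeff ([:- a, 1:] * q) i = coeff (pCons 0 q) i - a * coeff q i" for i
    by (simp add: mult_pCons_left)
  have "degree ([:- a, 1:] * q) \<le> Suc ?N"
    using degree_mult_le[of "[:- a, 1:]" q] by simp
  hence "apply_poly ([:- a, 1:] * q) c x =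
      (\<Sum>i\<le>Suc ?N. scale (coeff (pCons 0 q) i) ((c ^^ i) x))
        - (\<Sum>i\<le>Suc ?N. scale a (scale (coeff q i) ((c ^^ i) x)))"
    by (simp only: apply_poly_altdef coeff scale_left_diff_distrib sum_subtractf scale_scale)
  also have "(\<Sum>i\<le>Suc ?N. scale (coeff (pCons 0 q) i) ((c ^^ i) x)) = c (apply_poly q c x)"
    by (subst sum.atMost_Suc_shift) (simp add: apply_poly_def c.sum c.scale)
  also have "(\<Sum>i\<le>Suc ?N. scale a (scale (coeff q i) ((c ^^ i) x))) = scale a (apply_poly q c x)"
    by (simp only: scale_sum_right[symmetric] apply_poly_altdef[of q "Suc ?N"] le_SucI order_refl)
  finally show ?thesis .
qed

lemma linear_relation_among_iterates:
  obtains N u where "\<exists>i\<le>N. u i \<noteq> 0" "(\<Sum>i\<le>N. scale (u i) ((c ^^ i) x)) = 0"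
proof -
  let ?f = "\<lambda>i. (c ^^ i) x"
  obtain B where B: "finite B" "span B = UNIV" using finite_dim by blast
  let ?m = "card B"
  show thesis
  proof (cases "inj_on ?f {..?m}")
    case True
    hence "card (?f ` {..?m}) = Suc ?m" by (simp add: card_image)
    hence "dependent (?f ` {..?m})"
      using independent_span_bound[OF B(1), of "?f ` {..?m}"] B(2) by auto
    then obtain u where u: "\<exists>v\<in>?f ` {..?m}. u v \<noteq> 0" "(\<Sum>v\<in>?f ` {..?m}. scale (u v) v) = 0"
      by (subst (asm) dependent_finite) auto
    have "(\<Sum>i\<le>?m. scale (u (?f i)) (?f i)) = 0"
      using u(2) unfolding sum.reindex[OF True] o_def .
    thus thesis using u(1) by (intro that[of ?m "\<lambda>i. u (?f i)"]) auto
  next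
    case False
    then obtain i j where ij: "i \<le> ?m" "j \<le> ?m" "i \<noteq> j" "?f i = ?f j"
      by (auto simp: inj_on_def)
    let ?u = "\<lambda>t. (if t = i then 1 else 0) - (if t = j then 1 else 0) :: complex"
    have "(\<Sum>t\<le>?m. scale (?u t) (?f t)) =
        (\<Sum>t\<le>?m. if t = i then ?f t else 0) - (\<Sum>t\<le>?m. if t = j then ?f t else 0)"
      unfolding sum_subtractf[symmetric] by (intro sum.cong) auto
    also have "\<dots> = 0" using ij by simp
    finally have "(\<Sum>t\<le>?m. scale (?u t) (?f t)) = 0" .
    moreover have "?u i \<noteq> 0" using ij by simp
    ultimately show thesis using ij(1) by (intro that[of ?m ?u]) blast
  qed
qed

lemma annihilating_poly_exists: "\<exists>p. p \<noteq> 0 \<and> apply_poly p c x = 0"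
proof -
  obtain N u where u: "\<exists>i\<le>N. u i \<noteq> 0" "(\<Sum>i\<le>N. scale (u i) ((c ^^ i) x)) = 0"
    by (rule linear_relation_among_iterates[of c x])
  define p where "p = (\<Sum>i\<le>N. monom (u i) i)"
  have coeff: "coeff p i = u i" if "i \<le> N" for i
    using that by (simp add: p_def coeff_sum)
  have "degree p \<le> N" unfolding p_def
    by (intro degree_sum_le) (auto intro: order_trans[OF degree_monom_le])
  hence "apply_poly p c x = 0" using u(2) coeff by (simp add: apply_poly_altdef)
  moreover have "p \<noteq> 0" using u(1) coeff by force
  ultimately show ?thesis by blast
qed

text \<open>
  Among the nonzero polynomials \<open>p\<close> with \<open>p(c) x = 0\<close> take one of least degree and split off
  a root: \<open>p = (X - a) q\<close>.  Then \<open>q(c) x\<close> is nonzero by minimality and \<open>c\<close> multiplies it by \<open>a\<close>.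
  It is a combination of the iterates of \<open>x\<close>, so it stays in the subspace.
\<close>

lemma eigenvector_in_invariant_subspace:
  assumes c: "Vector_Spaces.linear scale scale c" and V: "subspace V" "\<And>x. x \<in> V \<Longrightarrow> c x \<in> V"
    and x: "x \<in> V" "x \<noteq> 0"
  obtains y a where "y \<in> V" "y \<noteq> 0" "c y = scale a y"
proof -
  obtain p where p: "p \<noteq> 0" "apply_poly p c x = 0"
    and least: "\<And>q. \<lbrakk>q \<noteq> 0; apply_poly q c x = 0\<rbrakk> \<Longrightarrow> degree p \<le> degree q"
    using ex_has_least_nat[of "\<lambda>p. p \<noteq> 0 \<and> apply_poly p c x = 0" _ degree]
      annihilating_poly_exists[of c x] by blast
  have "degree p \<noteq> 0"
  proof
    assume d: "degree p = 0"
    hence "scale (coeff p 0) x = 0" using p(2) by (simp add: apply_poly_def)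
    hence "lead_coeff p = 0" using x(2) d by simp
    thus False using p(1) by simp
  qed
  then obtain a where "poly p a = 0"
    using fundamental_theorem_of_algebra[of p] by (auto simp: constant_degree)
  then obtain q where q: "p = [:- a, 1:] * q" by (auto simp: poly_eq_0_iff_dvd)
  have "q \<noteq> 0" using q p(1) by auto
  hence "degree q < degree p" unfolding q by (subst degree_mult_eq) auto
  hence "apply_poly q c x \<noteq> 0" using least[of q] \<open>q \<noteq> 0\<close> by auto
  moreover have "c (apply_poly q c x) = scale a (apply_poly q c x)"
    using p(2) unfolding q apply_poly_linear_factor[OF c] by simp
  moreover have "apply_poly q c x \<in> V"
  proof -
    have "(c ^^ i) x \<in> V" for i by (induction i) (auto simp: x V)
    thus ?thesis unfolding apply_poly_def by (intro subspace_sum subspace_scale V)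
  qed
  ultimately show ?thesis using that by blast
qed

text \<open>
  As \<open>c\<close> and its adjoint commute at \<open>b\<close>, the vectors \<open>(c - \<kappa>) b\<close> and \<open>(c\<^sup>* - \<kappa>\<^sup>*) b\<close> have the same norm.
\<close>

lemma normal_eigenvector_of_adjoint:
  assumes adj: "\<And>x y. ip (c x) y = ip x (d y)" and comm: "c (d b) = d (c b)"
    and b: "c b = scale \<kappa> b"
  shows "d b = scale (cnj \<kappa>) b"
proof -
  have adj': "ip (d x) y = ip x (c y)" for x y using adj ip_commute by metis
  have "ip (d b) (d b) = ip (c b) (c b)" by (metis adj adj' comm)
  moreover have "ip (d b) b = cnj \<kappa> * ip b b" by (simp add: adj' b ip_scale_right)
  moreover have "ip b (d b) = \<kappa> * ip b b" by (simp add: adj[symmetric] b ip_scale_left)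
  ultimately have "ip (d b - scale (cnj \<kappa>) b) (d b - scale (cnj \<kappa>) b) = 0"
    by (simp add: ip_expand b)
  thus ?thesis by (simp add: ip_self_eq_0_iff)
qed

lemma orthonormal_tuple_independent:
  assumes e: "orthonormal_tuple ip m e"
  shows "inj_on e {1..m}" "independent (e ` {1..m})"
proof -
  show inj: "inj_on e {1..m}"
    by (rule inj_onI) (metis orthonormal_tupleD[OF e] zero_neq_one)
  show "independent (e ` {1..m})"
  proof (rule independent_if_scalars_zero)
    fix f y assume z: "(\<Sum>y\<in>e ` {1..m}. scale (f y) y) = 0" and "y \<in> e ` {1..m}"
    then obtain j where j: "j \<in> {1..m}" "y = e j" by blast
    have "0 = ip (\<Sum>i=1..m. scale (f (e i)) (e i)) (e j)"
      using z unfolding sum.reindex[OF inj] o_def by simp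
    also have "\<dots> = (\<Sum>i=1..m. if i = j then f (e i) else 0)"
      unfolding ip_sum_left ip_scale_left
      using j by (intro sum.cong) (auto simp: orthonormal_tupleD[OF e])
    also have "\<dots> = f y" using j by simp
    finally show "f y = 0" by simp
  qed simp
qed

lemma orthonormal_basis_dim:
  assumes e: "orthonormal_basis m e"
  shows "m = dim UNIV"
proof -
  have t: "orthonormal_tuple ip m e" using e by (simp add: orthonormal_basis_def)
  have "x \<in> span (e ` {1..m})" for x
    by (subst orthonormal_basis_expansion[OF e, of x])
      (intro span_sum span_scale span_base imageI)
  hence "span (e ` {1..m}) = span UNIV" by auto
  hence "dim UNIV = card (e ` {1..m})"
    by (rule dim_eq_card[OF _ orthonormal_tuple_independent(2)[OF t]])
  thus ?thesis using card_image[OF orthonormal_tuple_independent(1)[OF t]] by simp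
qed

lemma normalize_vector:
  assumes "y \<noteq> 0"
  obtains r where "ip (scale r y) (scale r y) = 1"
proof -
  have re: "Re (ip y y) > 0"
    using assms ip_nonneg[of y] ip_self[of y] ip_definite[of y] by (metis less_le of_real_0)
  let ?r = "complex_of_real (1 / sqrt (Re (ip y y)))"
  have "ip (scale ?r y) (scale ?r y) = ?r * ?r * ip y y"
    by (simp only: ip_scale_left ip_scale_right complex_cnj_complex_of_real mult.assoc)
  also have "\<dots> = of_real (1 / sqrt (Re (ip y y)) * (1 / sqrt (Re (ip y y))) * Re (ip y y))"
    unfolding of_real_mult ip_self[of y, symmetric] ..
  also have "1 / sqrt (Re (ip y y)) * (1 / sqrt (Re (ip y y))) * Re (ip y y) = 1"
    using re by simp
  also have "complex_of_real 1 = 1" by simp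
  finally show ?thesis by (rule that)
qed

text \<open>
  A maximal orthonormal tuple of eigenvectors is a basis: its members are also
  eigenvectors of the adjoint (\<open>normal_eigenvector_of_adjoint\<close>), so \<open>c\<close> preserves their orthogonal complement, and a
  nonzero complement would contain a further eigenvector.
\<close>

theorem normal_eigenbasis:
  assumes c: "Vector_Spaces.linear scale scale c"
    and adj: "\<And>x y. ip (c x) y = ip x (d y)" and comm: "\<And>x. c (d x) = d (c x)"
  obtains e \<kappa> where "orthonormal_basis (dim UNIV) e"
    "\<And>j. j \<in> {1..dim UNIV} \<Longrightarrow> c (e j) = scale (\<kappa> j) (e j)"
    "\<And>j. j \<in> {1..dim UNIV} \<Longrightarrow> d (e j) = scale (cnj (\<kappa> j)) (e j)"
proof -
  interpret c: Vector_Spaces.linear scale scale c by (rule c)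
  define P where "P m \<longleftrightarrow> (\<exists>e. orthonormal_tuple ip m e \<and> (\<forall>j\<in>{1..m}. \<exists>a. c (e j) = scale a (e j)))"
    for m
  obtain B where B: "finite B" "span B = UNIV" using finite_dim by blast
  have bound: "m < Suc (card B)" if Pm: "P m" for m
  proof -
    obtain e where e: "orthonormal_tuple ip m e" using Pm unfolding P_def by blast
    show ?thesis
      using independent_span_bound[OF B(1) orthonormal_tuple_independent(2)[OF e]] B(2)
        card_image[OF orthonormal_tuple_independent(1)[OF e]] by simp
  qed
  have "P 0" by (simp add: P_def orthonormal_tuple_def)
  then obtain m where m: "P m" "\<And>k. P k \<Longrightarrow> k \<le> m"
    using ex_has_greatest_nat[of P 0 "\<lambda>m. m"] bound by blast
  then obtain e where e: "orthonormal_tuple ip m e"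
    and ev: "\<forall>j\<in>{1..m}. \<exists>a. c (e j) = scale a (e j)" by (auto simp: P_def)
  from ev obtain \<kappa> where cl: "\<And>j. j \<in> {1..m} \<Longrightarrow> c (e j) = scale (\<kappa> j) (e j)" by metis
  have dl: "d (e j) = scale (cnj (\<kappa> j)) (e j)" if "j \<in> {1..m}" for j
    using normal_eigenvector_of_adjoint[OF adj comm cl[OF that]] .
  let ?V = "{x. \<forall>j\<in>{1..m}. ip x (e j) = 0}"
  have V: "subspace ?V" by (auto intro!: subspaceI simp: ip_add_left ip_scale_left)
  have inv: "c x \<in> ?V" if "x \<in> ?V" for x
    using that by (simp add: adj dl ip_scale_right)
  have "x = 0" if "x \<in> ?V" for x
  proof (rule ccontr)
    assume "x \<noteq> 0"
    then obtain y a where y: "y \<in> ?V" "y \<noteq> 0" "c y = scale a y"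
      using eigenvector_in_invariant_subspace[OF c V inv \<open>x \<in> ?V\<close>] by blast
    obtain r where r: "ip (scale r y) (scale r y) = 1" using normalize_vector[OF y(2)] by blast
    let ?e = "e(Suc m := scale r y)"
    have "ip (scale r y) (e j) = 0" "ip (e j) (scale r y) = 0" if "j \<in> {1..m}" for j
      using y(1) that ip_eq_0_commute[of "e j" y] by (simp_all add: ip_scale_left ip_scale_right)
    hence "orthonormal_tuple ip (Suc m) ?e"
      using r orthonormal_tupleD[OF e] by (auto simp: orthonormal_tuple_def le_Suc_eq)
    moreover have "c (scale r y) = scale a (scale r y)"
      by (simp add: c.scale y(3) mult.commute)
    hence "\<forall>j\<in>{1..Suc m}. \<exists>a. c (?e j) = scale a (?e j)"
      using cl by (auto simp: le_Suc_eq)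
    ultimately have "P (Suc m)" unfolding P_def by blast
    thus False using m(2) by fastforce
  qed
  hence basis: "orthonormal_basis m e" using e by (simp add: orthonormal_basis_def)
  show ?thesis using that basis cl dl orthonormal_basis_dim[OF basis] by blast
qed

corollary orthonormal_basis_exists:
  obtains e where "orthonormal_basis (dim UNIV) e"
  by (rule normal_eigenbasis[OF linear_ident, of "\<lambda>x. x"]) (auto intro: that)

lemma adjoint_exists:
  assumes c: "Vector_Spaces.linear scale scale c"
  obtains d where "\<And>x y. ip (c x) y = ip x (d y)"
proof -
  interpret c: Vector_Spaces.linear scale scale c by (rule c)
  obtain e where e: "orthonormal_basis (dim UNIV) e" using orthonormal_basis_exists .
  let ?d = "\<lambda>y. \<Sum>j=1..dim UNIV. scale (ip y (c (e j))) (e j)"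
  have "ip (c x) y = ip x (?d y)" for x y
  proof -
    have "ip x (?d y) = (\<Sum>j=1..dim UNIV. ip x (e j) * ip (c (e j)) y)"
      by (simp add: ip_expand ip_commute[of _ y, symmetric] mult.commute)
    also have "\<dots> = ip (c (\<Sum>j=1..dim UNIV. scale (ip x (e j)) (e j))) y"
      by (simp add: c.sum c.scale ip_expand)
    also have "\<dots> = ip (c x) y" using orthonormal_basis_expansion[OF e, of x] by simp
    finally show ?thesis by simp
  qed
  thus ?thesis by (rule that)
qed

lemma hilbert_adjoint_eq:
  assumes adj: "\<And>x y. ip (c x) y = ip x (d y)"
  shows "hilbert_adjoint ip c = d"
  unfolding hilbert_adjoint_def
proof (rule the_equality)
  fix d' assume d': "\<forall>x y. ip (c x) y = ip x (d' y)"
  show "d' = d"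
  proof
    fix y
    have "ip (d' y - d y) (d' y - d y) = 0"
      using d' adj by (metis ip_diff_right right_minus_eq)
    thus "d' y = d y" by (simp add: ip_self_eq_0_iff)
  qed
qed (use adj in blast)

lemma normal_operator_iff:
  assumes adj: "\<And>x y. ip (c x) y = ip x (d y)"
  shows "normal_operator ip c \<longleftrightarrow> (\<forall>x. c (d x) = d (c x))"
  by (simp add: normal_operator_def hilbert_adjoint_eq[of c d, OF adj] fun_eq_iff)

section \<open>Numerical ranges of normal operators\<close>

lemma k_numerical_rangeI:
  "orthonormal_tuple ip k x \<Longrightarrow>
     1 / of_nat k * (\<Sum>i=1..k. ip (c (x i)) (x i)) \<in> k_numerical_range ip k c"
  unfolding k_numerical_range_def by blast

lemma sum_ip_diagonal:
  assumes e: "orthonormal_basis n e"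
    and diag: "\<And>x j. j \<in> {1..n} \<Longrightarrow> ip (c x) (e j) = \<kappa> j * ip x (e j)"
  shows "(\<Sum>i=1..k. ip (c (x i)) (x i)) = (\<Sum>j=1..n. weight k x (e j) *\<^sub>R \<kappa> j)"
proof -
  have "ip (c y) y = (\<Sum>j=1..n. (cmod (ip y (e j)))\<^sup>2 *\<^sub>R \<kappa> j)" for y
    unfolding parseval[OF e, of "c y" y]
    by (intro sum.cong refl)
      (simp add: diag scaleR_conv_of_real complex_norm_square mult_ac del: of_real_power)
  hence "(\<Sum>i=1..k. ip (c (x i)) (x i)) =
      (\<Sum>i=1..k. \<Sum>j=1..n. (cmod (ip (x i) (e j)))\<^sup>2 *\<^sub>R \<kappa> j)" by simp
  thus ?thesis by (subst (asm) sum.swap) (simp add: weight_def scaleR_sum_left)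
qed

text \<open>
  The diagonality of \<open>c\<close> is stated through coordinates, as an identity for \<open>\<langle>c x, e\<^sub>j\<rangle>\<close>.
  Parseval's identity consumes it in this form, and it follows at once from eigenvectors of the adjoint.
\<close>

lemma k_numerical_range_diagonal:
  assumes e: "orthonormal_basis n e"
    and diag: "\<And>x j. j \<in> {1..n} \<Longrightarrow> ip (c x) (e j) = \<kappa> j * ip x (e j)"
  shows "k_numerical_range ip k c =
    (\<lambda>p. \<Sum>j=1..n. p j *\<^sub>R ((1 / of_nat k) * \<kappa> j)) ` hypersimplex n k"
    (is "_ = ?F ` _")
proof -
  have F: "1 / of_nat k * (\<Sum>i=1..k. ip (c (x i)) (x i)) = ?F (\<lambda>j. weight k x (e j))" for x
    by (simp only: sum_ip_diagonal[OF e diag] sum_distrib_left mult_scaleR_right)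
  have t: "orthonormal_tuple ip n e" using e by (simp add: orthonormal_basis_def)
  show ?thesis
  proof
    show "k_numerical_range ip k c \<subseteq> ?F ` hypersimplex n k"
    proof
      fix z assume "z \<in> k_numerical_range ip k c"
      then obtain x where x: "orthonormal_tuple ip k x" "z = ?F (\<lambda>j. weight k x (e j))"
        unfolding k_numerical_range_def F by blast
      from x(2) weight_in_hypersimplex[OF e x(1)] show "z \<in> ?F ` hypersimplex n k"
        by (rule image_eqI)
    qed
    show "?F ` hypersimplex n k \<subseteq> k_numerical_range ip k c"
    proof
      fix z assume "z \<in> ?F ` hypersimplex n k"
      then obtain p where p: "p \<in> hypersimplex n k" "z = ?F p" by blast
      obtain x where x: "orthonormal_tuple ip k x" "\<forall>j\<in>{1..n}. weight k x (e j) = p j"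
        using carpenter[OF p(1) t] by blast
      have "z = 1 / of_nat k * (\<Sum>i=1..k. ip (c (x i)) (x i))"
        unfolding F p(2) using x(2) by (intro sum.cong) auto
      thus "z \<in> k_numerical_range ip k c" using k_numerical_rangeI[OF x(1)] by simp
    qed
  qed
qed

theorem normal_imp_polytope:
  assumes c: "Vector_Spaces.linear scale scale c" and normal: "normal_operator ip c"
  shows "polytope (k_numerical_range ip k c)"
proof -
  obtain d where adj: "\<And>x y. ip (c x) y = ip x (d y)" using adjoint_exists[OF c] by blast
  have comm: "c (d x) = d (c x)" for x using normal normal_operator_iff[of c d, OF adj] by blast
  obtain e \<kappa> where e: "orthonormal_basis (dim UNIV) e"
    and dl: "\<And>j. j \<in> {1..dim UNIV} \<Longrightarrow> d (e j) = scale (cnj (\<kappa> j)) (e j)"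
    using normal_eigenbasis[of c d, OF c adj comm] by metis
  have "ip (c x) (e j) = \<kappa> j * ip x (e j)" if "j \<in> {1..dim UNIV}" for x j
    by (simp add: adj dl[OF that] ip_scale_right)
  from k_numerical_range_diagonal[OF e this] show ?thesis
    by (simp only: polytope_hypersimplex_image)
qed

section \<open>Operators with polygonal numerical ranges\<close>

lemma diagonal_imp_normal:
  assumes c: "Vector_Spaces.linear scale scale c" and e: "orthonormal_basis n e"
    and off: "\<And>j l. \<lbrakk>j \<in> {1..n}; l \<in> {1..n}; j \<noteq> l\<rbrakk> \<Longrightarrow> ip (c (e j)) (e l) = 0"
  shows "normal_operator ip c"
proof -
  interpret c: Vector_Spaces.linear scale scale c by (rule c)
  obtain d where adj: "\<And>x y. ip (c x) y = ip x (d y)" using adjoint_exists[OF c] by blast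
  define \<kappa> where "\<kappa> j = ip (c (e j)) (e j)" for j
  have c_diag: "ip (c x) (e l) = \<kappa> l * ip x (e l)" if l: "l \<in> {1..n}" for x l
  proof -
    have "ip (c x) (e l) = ip (c (\<Sum>j=1..n. scale (ip x (e j)) (e j))) (e l)"
      using orthonormal_basis_expansion[OF e, of x] by simp
    also have "\<dots> = (\<Sum>j=1..n. ip x (e j) * ip (c (e j)) (e l))"
      by (simp add: c.sum c.scale ip_expand)
    also have "\<dots> = (\<Sum>j=1..n. if j = l then ip x (e l) * \<kappa> l else 0)"
      using off l by (intro sum.cong) (auto simp: \<kappa>_def)
    also have "\<dots> = \<kappa> l * ip x (e l)" using l by simp
    finally show ?thesis .
  qed
  have d_diag: "ip (d x) (e l) = cnj (\<kappa> l) * ip x (e l)" if l: "l \<in> {1..n}" for x l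
  proof -
    have "ip (d x) (e l) = ip x (c (e l))" using adj ip_commute by metis
    also have "\<dots> = (\<Sum>j=1..n. ip x (e j) * cnj (ip (c (e l)) (e j)))" by (rule parseval[OF e])
    also have "\<dots> = (\<Sum>j=1..n. if j = l then ip x (e l) * cnj (\<kappa> l) else 0)"
      using off l by (intro sum.cong) (auto simp: \<kappa>_def)
    also have "\<dots> = cnj (\<kappa> l) * ip x (e l)" using l by simp
    finally show ?thesis .
  qed
  have "c (d x) = d (c x)" for x
    by (rule orthonormal_basis_eqI[OF e]) (simp add: c_diag d_diag)
  thus ?thesis using normal_operator_iff[of c d, OF adj] by blast
qed

text \<open>
  Replacing \<open>e\<^sub>j\<close> by \<open>\<surd>(1 - s\<^sup>2) e\<^sub>j + s u e\<^sub>l\<close> keeps the tuple orthonormal, since \<open>l\<close> lies outside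
  \<open>{1..k}\<close>, and moves the point \<open>m\<close> along a curve of the form considered in
  \<open>corner_tangent_zero\<close>.  The vanishing of its velocity for \<open>u = 1\<close> and \<open>u = \<i>\<close> gives two linear
  equations for the two off-diagonal entries.
\<close>

lemma corner_tuple_decouples:
  assumes c: "Vector_Spaces.linear scale scale c" and e: "orthonormal_tuple ip n e"
    and j: "j \<in> {1..k}" and l: "l \<in> {1..n}" "k < l"
    and \<epsilon>: "\<epsilon> > 0"
  defines "m \<equiv> 1 / of_nat k * (\<Sum>i=1..k. ip (c (e i)) (e i))"
  assumes corner: "\<And>z. z \<in> k_numerical_range ip k c \<Longrightarrow> w \<bullet> (z - m) + \<epsilon> * norm (z - m) \<le> 0"
  shows "ip (c (e j)) (e l) = 0" "ip (c (e l)) (e j) = 0"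
proof -
  interpret c: Vector_Spaces.linear scale scale c by (rule c)
  have k: "0 < k" "k \<le> n" "j \<in> {1..n}" "j \<noteq> l" using j l by auto
  let ?\<alpha> = "ip (c (e l)) (e j)" and ?\<beta> = "ip (c (e j)) (e l)"
  have zero: "u * ?\<alpha> + cnj u * ?\<beta> = 0" if u: "u * cnj u = 1" for u
  proof -
    let ?A = "1 / of_nat k * (ip (c (e l)) (e l) - ip (c (e j)) (e j))"
    let ?D = "1 / of_nat k * (u * ?\<alpha> + cnj u * ?\<beta>)"
    have "?D = 0"
    proof (rule corner_tangent_zero[OF \<epsilon>])
      fix s \<sigma> :: real assume s: "0 < s" "s < 1" and \<sigma>: "\<sigma> = 1 \<or> \<sigma> = -1"
      define r where "r = sqrt (1 - s\<^sup>2)"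
      have "s\<^sup>2 \<le> 1" using s by (simp add: power_le_one)
      hence r2: "r * r = 1 - s\<^sup>2" by (simp add: r_def)
      have r2': "complex_of_real r * of_real r = 1 - of_real s * of_real s"
        using r2 by (metis of_real_1 of_real_diff of_real_mult power2_eq_square)
      have \<sigma>2: "\<sigma> * \<sigma> = 1" using \<sigma> by auto
      define a where "a = of_real (\<sigma> * s) * u"
      have aa: "a * cnj a = of_real s * of_real s"
      proof -
        have "a * cnj a = of_real ((\<sigma> * \<sigma>) * (s * s)) * (u * cnj u)"
          by (simp add: a_def mult_ac)
        thus ?thesis by (simp add: u \<sigma>2)
      qed
      define y where "y = scale (of_real r) (e j) + scale a (e l)"
      have ortho: "ip (e j) (e j) = 1" "ip (e l) (e l) = 1" "ip (e j) (e l) = 0" "ip (e l) (e j) = 0"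
        using orthonormal_tupleD[OF e] k l by auto
      have yy: "ip y y = 1" by (simp add: y_def ip_expand ortho r2' aa[unfolded mult.commute[of a]])
      have "ip y (e i) = 0" if "i \<in> {1..k}" "i \<noteq> j" for i
        using that orthonormal_tupleD[OF e] k l by (auto simp: y_def ip_expand)
      hence tup: "orthonormal_tuple ip k (e(j := y))"
        using orthonormal_tuple_update[OF orthonormal_tuple_mono[OF e k(2)] yy] by blast
      let ?z = "1 / of_nat k * (\<Sum>i=1..k. ip (c ((e(j := y)) i)) ((e(j := y)) i))"
      have "?z \<in> k_numerical_range ip k c" by (rule k_numerical_rangeI[OF tup])
      note cz = corner[OF this]
      have "(\<Sum>i=1..k. ip (c ((e(j := y)) i)) ((e(j := y)) i)) =
          ip (c y) y + (\<Sum>i\<in>{1..k}-{j}. ip (c (e i)) (e i))"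
        using j by (subst sum.remove[of _ j]) (auto intro!: sum.cong)
      moreover have "(\<Sum>i=1..k. ip (c (e i)) (e i)) =
          ip (c (e j)) (e j) + (\<Sum>i\<in>{1..k}-{j}. ip (c (e i)) (e i))"
        using j by (subst sum.remove[of _ j]) auto
      ultimately have "?z - m = 1 / of_nat k * (ip (c y) y - ip (c (e j)) (e j))"
        unfolding m_def by (simp only: right_diff_distrib[symmetric]) simp
      also have "ip (c y) y = (of_real r * of_real r) * ip (c (e j)) (e j)
          + (a * cnj a) * ip (c (e l)) (e l) + of_real r * (a * ?\<alpha> + cnj a * ?\<beta>)"
        by (simp add: y_def c.add c.scale ip_expand algebra_simps)
      also have "a * ?\<alpha> + cnj a * ?\<beta> = of_real (\<sigma> * s) * (u * ?\<alpha> + cnj u * ?\<beta>)"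
        by (simp add: a_def algebra_simps)
      finally have "?z - m = s\<^sup>2 *\<^sub>R ?A + (\<sigma> * s * r) *\<^sub>R ?D"
        unfolding r2' aa by (simp add: scaleR_conv_of_real power2_eq_square algebra_simps)
      thus "w \<bullet> (s\<^sup>2 *\<^sub>R ?A + (\<sigma> * s * sqrt (1 - s\<^sup>2)) *\<^sub>R ?D)
          + \<epsilon> * norm (s\<^sup>2 *\<^sub>R ?A + (\<sigma> * s * sqrt (1 - s\<^sup>2)) *\<^sub>R ?D) \<le> 0"
        using cz by (simp only: r_def)
    qed
    thus ?thesis using k by simp
  qed
  have "?\<alpha> + ?\<beta> = 0" "\<i> * ?\<alpha> - \<i> * ?\<beta> = 0" using zero[of 1] zero[of \<i>] by simp_all
  hence "?\<alpha> = - ?\<beta>" "?\<alpha> = ?\<beta>" by (auto simp: add_eq_0_iff2 right_diff_distrib[symmetric])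
  thus "?\<beta> = 0" "?\<alpha> = 0" by auto
qed

lemma decreasing_reindexing:
  fixes \<mu> :: "nat \<Rightarrow> real"
  obtains g where "bij_betw g {1..n} {1..n}"
    "\<And>i j. \<lbrakk>i \<in> {1..n}; j \<in> {1..n}; i \<le> j\<rbrakk> \<Longrightarrow> \<mu> (g j) \<le> \<mu> (g i)"
proof -
  define xs where "xs = sort_key (\<lambda>j. - \<mu> j) [1..<Suc n]"
  have xs: "length xs = n" "distinct xs" "set xs = {1..n}"
    by (auto simp: xs_def)
  let ?g = "\<lambda>i. xs ! (i - 1)"
  have "inj_on ?g {1..n}"
    using xs by (auto intro!: inj_onI simp: nth_eq_iff_index_eq)
  moreover have "?g ` {1..n} \<subseteq> {1..n}"
    using xs nth_mem by fastforce
  ultimately have "bij_betw ?g {1..n} {1..n}"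
    by (simp add: bij_betw_def endo_inj_surj)
  moreover have "\<mu> (?g j) \<le> \<mu> (?g i)" if "i \<in> {1..n}" "j \<in> {1..n}" "i \<le> j" for i j
  proof -
    have "sorted (map (\<lambda>j. - \<mu> j) xs)" unfolding xs_def by (rule sorted_sort_key)
    from sorted_nth_mono[OF this, of "i - 1" "j - 1"] show ?thesis
      using that xs(1) by auto
  qed
  ultimately show ?thesis using that by blast
qed

text \<open>
  The basis diagonalises the self-adjoint operator \<open>h = (w\<^sup>* c + w c\<^sup>*) / 2\<close>,
  whose quadratic form is \<open>w \<bullet> \<langle>c x, x\<rangle>\<close>.
\<close>

lemma decreasing_eigenbasis_of_real_part:
  fixes w :: complex
  assumes c: "Vector_Spaces.linear scale scale c"
  obtains e \<mu> where "orthonormal_basis (dim UNIV) e"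
    "\<And>i j. \<lbrakk>i \<in> {1..dim UNIV}; j \<in> {1..dim UNIV}; i \<le> j\<rbrakk> \<Longrightarrow> \<mu> j \<le> \<mu> i"
    "\<And>k x. w \<bullet> (\<Sum>i=1..k. ip (c (x i)) (x i)) = (\<Sum>j=1..dim UNIV. weight k x (e j) * \<mu> j)"
proof -
  interpret c: Vector_Spaces.linear scale scale c by (rule c)
  let ?n = "dim UNIV"
  obtain d where adj: "\<And>x y. ip (c x) y = ip x (d y)" using adjoint_exists[OF c] by blast
  have adj': "ip (d x) y = ip x (c y)" for x y using adj ip_commute by metis
  \<comment> \<open>Linearity of \<open>h\<close> comes from its self-adjointness, by testing against all vectors.\<close>
  have eqI: "x = y" if "\<And>z. ip x z = ip y z" for x y
    using that[of "x - y"] ip_definite[of "x - y"] by (simp add: ip_diff_left)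
  define h where "h x = scale (cnj w / 2) (c x) + scale (w / 2) (d x)" for x
  have h_self: "ip (h x) y = ip x (h y)" for x y
    by (simp add: h_def ip_expand adj adj' algebra_simps)
  have "h (x + y) = h x + h y" "h (scale a x) = scale a (h x)" for x y a
    by (rule eqI, simp add: ip_add_left ip_scale_left h_self)+
  hence h: "Vector_Spaces.linear scale scale h"
    by (simp add: Vector_Spaces.linear_iff vector_space_axioms)
  obtain f \<kappa> where f: "orthonormal_basis ?n f"
    and hl: "\<And>j. j \<in> {1..?n} \<Longrightarrow> h (f j) = scale (\<kappa> j) (f j)"
    and hl': "\<And>j. j \<in> {1..?n} \<Longrightarrow> h (f j) = scale (cnj (\<kappa> j)) (f j)"
    using normal_eigenbasis[OF h h_self refl] by blast
  obtain g where g: "bij_betw g {1..?n} {1..?n}"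
    "\<And>i j. \<lbrakk>i \<in> {1..?n}; j \<in> {1..?n}; i \<le> j\<rbrakk> \<Longrightarrow> Re (\<kappa> (g j)) \<le> Re (\<kappa> (g i))"
    using decreasing_reindexing[of ?n "\<lambda>j. Re (\<kappa> j)"] by blast
  have g_inj: "inj_on g {1..?n}" and g_img: "g ` {1..?n} = {1..?n}"
    using g(1) by (auto simp: bij_betw_def)
  let ?e = "\<lambda>j. f (g j)"
  have e: "orthonormal_basis ?n ?e"
  proof -
    have "orthonormal_tuple ip ?n ?e"
      using f g_img by (intro orthonormal_tuple_reindex[OF _ g_inj]) (auto simp: orthonormal_basis_def)
    moreover have "x = 0" if "\<forall>j\<in>{1..?n}. ip x (?e j) = 0" for x
    proof -
      have "\<forall>j\<in>g ` {1..?n}. ip x (f j) = 0" using that by blast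
      thus ?thesis using f unfolding g_img orthonormal_basis_def by blast
    qed
    ultimately show ?thesis by (auto simp: orthonormal_basis_def)
  qed
  have diag: "ip (h x) (?e j) = of_real (Re (\<kappa> (g j))) * ip x (?e j)" if "j \<in> {1..?n}" for x j
  proof -
    have gj: "g j \<in> {1..?n}" using that g_img by blast
    have "ip (f (g j)) (f (g j)) = 1"
      using f gj orthonormal_tupleD[of ?n f "g j" "g j"] by (simp add: orthonormal_basis_def)
    hence "\<kappa> (g j) = cnj (\<kappa> (g j))"
      using hl[OF gj] hl'[OF gj] by (metis ip_scale_left mult.right_neutral)
    hence "cnj (\<kappa> (g j)) = of_real (Re (\<kappa> (g j)))"
      by (simp add: complex_eq_iff)
    moreover have "ip (h x) (?e j) = cnj (\<kappa> (g j)) * ip x (?e j)"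
      by (simp add: h_self hl[OF gj] ip_scale_right)
    ultimately show ?thesis by simp
  qed
  have h_form: "Re (ip (h x) x) = w \<bullet> ip (c x) x" for x
  proof -
    have "ip (h x) x = cnj w / 2 * ip (c x) x + w / 2 * cnj (ip (c x) x)"
      by (simp add: h_def ip_expand adj' ip_commute[of x "c x"])
    thus ?thesis by (simp add: inner_complex_def)
  qed
  have form: "w \<bullet> (\<Sum>i=1..k. ip (c (x i)) (x i)) = (\<Sum>j=1..?n. weight k x (?e j) * Re (\<kappa> (g j)))" for k x
  proof -
    have "w \<bullet> (\<Sum>i=1..k. ip (c (x i)) (x i)) = Re (\<Sum>i=1..k. ip (h (x i)) (x i))"
      by (simp add: inner_sum_right h_form)
    also have "\<dots> = (\<Sum>j=1..?n. weight k x (?e j) * Re (\<kappa> (g j)))"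
      by (subst sum_ip_diagonal[OF e diag]) simp_all
    finally show ?thesis .
  qed
  show ?thesis using that[of ?e "\<lambda>j. Re (\<kappa> (g j))"] e g(2) form by blast
qed

lemma weight_initial_segment:
  assumes e: "orthonormal_tuple ip n e" and j: "j \<in> {1..n}" and k: "k \<le> n"
  shows "weight k e (e j) = (if j \<le> k then 1 else 0)"
proof -
  have "weight k e (e j) = (\<Sum>i=1..k. if i = j then 1 else 0)"
    unfolding weight_def using j k by (intro sum.cong) (auto simp: orthonormal_tupleD[OF e])
  thus ?thesis using j by simp
qed

text \<open>
  One basis \<open>e\<close> serves all \<open>k\<close>, because the direction \<open>w\<close> separates the vertices of all the
  polygons simultaneously.  To decouple \<open>e\<^sub>j\<close> from \<open>e\<^sub>l\<close> for \<open>j < l\<close>, the range with \<open>k = j\<close> suffices.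
\<close>

theorem polytope_imp_normal:
  assumes c: "Vector_Spaces.linear scale scale c"
    and poly: "\<And>k. \<lbrakk>0 < k; k < dim UNIV\<rbrakk> \<Longrightarrow> polytope (k_numerical_range ip k c)"
  shows "normal_operator ip c"
proof -
  let ?n = "dim UNIV" and ?W = "\<lambda>k. k_numerical_range ip k c"
  have "\<forall>k\<in>{0<..<?n}. \<exists>V. finite V \<and> ?W k = convex hull V"
    using poly by (auto simp: polytope_def)
  from bchoice[OF this] obtain V where V: "\<And>k. k \<in> {0<..<?n} \<Longrightarrow> finite (V k)"
    "\<And>k. k \<in> {0<..<?n} \<Longrightarrow> ?W k = convex hull (V k)" by blast
  define D where "D = (\<Union>k\<in>{0<..<?n}. (\<lambda>(u, v). u - v) ` (V k \<times> V k)) - {0}"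
  have "finite D" using V(1) by (simp add: D_def)
  then obtain w where w: "\<And>d. d \<in> D \<Longrightarrow> w \<bullet> d \<noteq> 0"
    using ex_direction_nonorthogonal[of D] by (auto simp: D_def)
  obtain e \<mu> where e: "orthonormal_basis ?n e"
    and mono: "\<And>i j. \<lbrakk>i \<in> {1..?n}; j \<in> {1..?n}; i \<le> j\<rbrakk> \<Longrightarrow> \<mu> j \<le> \<mu> i"
    and form: "\<And>k x. w \<bullet> (\<Sum>i=1..k. ip (c (x i)) (x i)) = (\<Sum>j=1..?n. weight k x (e j) * \<mu> j)"
    using decreasing_eigenbasis_of_real_part[OF c, of w] by blast
  have t: "orthonormal_tuple ip ?n e" using e by (simp add: orthonormal_basis_def)
  have decouple: "ip (c (e j)) (e l) = 0 \<and> ip (c (e l)) (e j) = 0"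
    if jl: "j \<in> {1..?n}" "l \<in> {1..?n}" "j < l" for j l
  proof -
    have k: "j \<in> {0<..<?n}" using jl by auto
    let ?m = "1 / of_nat j * (\<Sum>i=1..j. ip (c (e i)) (e i))"
    have inner_mean: "w \<bullet> (1 / of_nat j * z) = (w \<bullet> z) / real j" for z
      using inner_scaleR_right[of w "1 / real j" z] by (simp add: scaleR_conv_of_real)
    have m: "?m \<in> ?W j"
      using k by (intro k_numerical_rangeI orthonormal_tuple_mono[OF t]) auto
    have m_val: "w \<bullet> ?m = (\<Sum>i=1..j. \<mu> i) / real j"
    proof -
      have "(\<Sum>i=1..?n. weight j e (e i) * \<mu> i) = (\<Sum>i=1..?n. if i \<le> j then \<mu> i else 0)"
        using weight_initial_segment[OF t] k by (intro sum.cong) auto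
      also have "\<dots> = (\<Sum>i\<in>{i\<in>{1..?n}. i \<le> j}. \<mu> i)" by (subst sum.inter_filter) auto
      also have "{i\<in>{1..?n}. i \<le> j} = {1..j}" using k by auto
      finally show ?thesis unfolding inner_mean form by simp
    qed
    have max: "w \<bullet> z \<le> w \<bullet> ?m" if z: "z \<in> ?W j" for z
    proof -
      obtain x where x: "orthonormal_tuple ip j x" "z = 1 / of_nat j * (\<Sum>i=1..j. ip (c (x i)) (x i))"
        using z unfolding k_numerical_range_def by blast
      have "(\<Sum>i=1..?n. weight j x (e i) * \<mu> i) \<le> (\<Sum>i=1..j. \<mu> i)"
        using k mono by (intro hypersimplex_sum_le_top[OF weight_in_hypersimplex[OF e x(1)]]) auto
      thus ?thesis unfolding m_val unfolding x(2) inner_mean form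
        by (simp add: divide_right_mono)
    qed
    have inj: "w \<bullet> (u - v) \<noteq> 0" if "u \<in> V j" "v \<in> V j" "u \<noteq> v" for u v
    proof (rule w)
      have "(u, v) \<in> V j \<times> V j" using that by blast
      hence "u - v \<in> (\<lambda>(u, v). u - v) ` (V j \<times> V j)" by (rule rev_image_eqI) simp
      thus "u - v \<in> D" unfolding D_def using k that(3) by (intro DiffI UN_I[of j]) auto
    qed
    obtain \<epsilon> where \<epsilon>: "\<epsilon> > 0" "\<And>z. z \<in> ?W j \<Longrightarrow> w \<bullet> (z - ?m) + \<epsilon> * norm (z - ?m) \<le> 0"
      using unique_maximum_is_corner[of "V j" w ?m, OF V(1)[OF k] inj] m max
      unfolding V(2)[OF k] by blast
    show ?thesis
      using corner_tuple_decouples[OF c t _ jl(2,3) \<epsilon>(1) \<epsilon>(2), of j] k by simp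
  qed
  show ?thesis
  proof (rule diagonal_imp_normal[OF c e])
    fix j l assume "j \<in> {1..?n}" "l \<in> {1..?n}" "j \<noteq> l"
    thus "ip (c (e j)) (e l) = 0" using decouple[of j l] decouple[of l j] by (cases "j < l") auto
  qed
qed

end

section \<open>The equivalence\<close>

theorem theorem3p5:
  fixes scale :: "complex \<Rightarrow> 'a::ab_group_add \<Rightarrow> 'a"
    and ip :: "'a \<Rightarrow> 'a \<Rightarrow> complex"
    and c :: "'a \<Rightarrow> 'a"
    and n :: nat
  assumes "finite_dim_complex_hilbert scale ip"
    and "vector_space.dim scale (UNIV :: 'a set) = n"
    and "Vector_Spaces.linear scale scale c"
  shows "normal_operator ip c \<longleftrightarrow>
    (\<forall>k. 0 < k \<and> k < n \<longrightarrow> polytope (k_numerical_range ip k c))"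
proof -
  interpret finite_dim_complex_hilbert scale ip by (rule assms(1))
  show ?thesis
    using normal_imp_polytope[OF assms(3)] polytope_imp_normal[OF assms(3)] assms(2) by blast
qed

end
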